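(* Let $n>2$. Every nilpotent element $X\in\mathfrak{sl}_n(\mathbb{H})$ is strongly real, i.e. there is $\tau\in\mathrm{SL}_n(\mathbb{H})$ with $\tau^2=\mathrm{Id}$ and $\tau X\tau^{-1}=-X$.
   Context: $\mathbb{H}$ denotes the real quaternions. $\mathrm{SL}_n(\mathbb{H})=\{g\in\mathrm{GL}_n(\mathbb{H})\mid \mathrm{Nrd}_{\mathrm{M}_n(\mathbb{H})}(g)=1\}$ and $\mathfrak{sl}_n(\mathbb{H})=\{z\in\mathrm{M}_n(\mathbb{H})\mid\mathrm{Trd}_{\mathrm{M}_n(\mathbb{H})}(z)=0\}$, where $\mathrm{Nrd}$ and $\mathrm{Trd}$ are the reduced norm and reduced trace of the central simple $\mathbb{R}$-algebra $\mathrm{M}_n(\mathbb{H})$. For a Lie group $G$ with Lie algebra $\mathfrak{g}$, $X\in\mathfrak{g}$ is strongly real (strongly $\mathrm{Ad}_G$-real) if $-X=\mathrm{Ad}(\tau)X$ for some $\tau\in G$ with $\tau^2=\mathrm{Id}$. *)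

theory Defs
  imports "Jordan_Normal_Form.Determinant"
begin

section \<open>The real quaternions\<close>

text \<open>\<open>Quat a b c d\<close> stands for $a + b i + c j + d k$.\<close>

datatype quat = Quat (qre: real) (qi: real) (qj: real) (qk: real)

lemma quat_eq_iff: "x = y \<longleftrightarrow> qre x = qre y \<and> qi x = qi y \<and> qj x = qj y \<and> qk x = qk y"
  by (cases x; cases y) simp

instantiation quat :: real_div_algebra
begin

definition "0 = Quat 0 0 0 0"
definition "1 = Quat 1 0 0 0"
definition "x + y = Quat (qre x + qre y) (qi x + qi y) (qj x + qj y) (qk x + qk y)"
definition "- x = Quat (- qre x) (- qi x) (- qj x) (- qk x)"
definition "x - y = Quat (qre x - qre y) (qi x - qi y) (qj x - qj y) (qk x - qk y)"
definition "r *\<^sub>R x = Quat (r * qre x) (r * qi x) (r * qj x) (r * qk x)"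
definition "x * y = Quat
  (qre x * qre y - qi x * qi y - qj x * qj y - qk x * qk y)
  (qre x * qi y + qi x * qre y + qj x * qk y - qk x * qj y)
  (qre x * qj y - qi x * qk y + qj x * qre y + qk x * qi y)
  (qre x * qk y + qi x * qj y - qj x * qi y + qk x * qre y)"
definition "inverse x = (1 / ((qre x)\<^sup>2 + (qi x)\<^sup>2 + (qj x)\<^sup>2 + (qk x)\<^sup>2)) *\<^sub>R
  Quat (qre x) (- qi x) (- qj x) (- qk x)"
definition "x div y = x * inverse (y :: quat)"

lemmas quat_defs = zero_quat_def one_quat_def plus_quat_def uminus_quat_def minus_quat_def
  scaleR_quat_def times_quat_def inverse_quat_def divide_quat_def

lemma quat_norm_pos:
  assumes "x \<noteq> 0"
  shows "(qre x)\<^sup>2 + (qi x)\<^sup>2 + (qj x)\<^sup>2 + (qk x)\<^sup>2 > 0"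
proof -
  have nz: "qre x \<noteq> 0 \<or> qi x \<noteq> 0 \<or> qj x \<noteq> 0 \<or> qk x \<noteq> 0"
    using assms by (auto simp: quat_eq_iff zero_quat_def)
  have "(qre x)\<^sup>2 \<ge> 0" "(qi x)\<^sup>2 \<ge> 0" "(qj x)\<^sup>2 \<ge> 0" "(qk x)\<^sup>2 \<ge> 0" by simp_all
  moreover have "(qre x)\<^sup>2 > 0 \<or> (qi x)\<^sup>2 > 0 \<or> (qj x)\<^sup>2 > 0 \<or> (qk x)\<^sup>2 > 0"
    using nz by auto
  ultimately show ?thesis by linarith
qed

instance
proof
  fix x :: quat
  assume nz: "x \<noteq> 0"
  let ?N = "(qre x)\<^sup>2 + (qi x)\<^sup>2 + (qj x)\<^sup>2 + (qk x)\<^sup>2"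
  have N: "?N \<noteq> 0" using quat_norm_pos[OF nz] by linarith
  show "inverse x * x = 1"
    unfolding quat_eq_iff using N
    by (simp add: quat_defs) (simp add: power2_eq_square add_divide_distrib [symmetric])
  show "x * inverse x = 1"
    unfolding quat_eq_iff using N
    by (simp add: quat_defs) (simp add: power2_eq_square add_divide_distrib [symmetric])
qed (simp_all add: quat_eq_iff quat_defs algebra_simps)

end

section \<open>The splitting of the central simple algebra of quaternionic matrices\<close>

text \<open>
  With $a + b i + c j + d k = (a + b i) + (c + d i) j$, every quaternionic matrix is $Z + W j$
  with complex matrices $Z$ and $W$.
\<close>

definition qZ :: "quat \<Rightarrow> complex" where "qZ x = Complex (qre x) (qi x)"
definition qW :: "quat \<Rightarrow> complex" where "qW x = Complex (qj x) (qk x)"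

text \<open>
  Since $j z = \bar z j$ for complex $z$, the map below is a homomorphism of real algebras. Its
  complexification is an isomorphism onto the complex matrices of size $2n$, that is, a splitting
  of the central simple algebra. The reduced norm and the reduced trace are the
  determinant and the trace of the image under a splitting (any other splitting is conjugate to
  this one, so gives the same values).
\<close>

definition splitting :: "quat mat \<Rightarrow> complex mat" where
  "splitting A = four_block_mat (map_mat qZ A) (map_mat qW A)
     (- map_mat (cnj \<circ> qW) A) (map_mat (cnj \<circ> qZ) A)"

definition mat_trace :: "'a :: comm_monoid_add mat \<Rightarrow> 'a" where
  "mat_trace A = (\<Sum>i<dim_row A. A $$ (i, i))"

text \<open>Both values are real; they are kept as the complex numbers that the splitting yields.\<close>

definition Nrd :: "quat mat \<Rightarrow> complex" where "Nrd A = det (splitting A)"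
definition Trd :: "quat mat \<Rightarrow> complex" where "Trd A = mat_trace (splitting A)"

lemma quat_complex_parts:
  "qZ 0 = 0" "qW 0 = 0" "qZ 1 = 1" "qW 1 = 0"
  "qZ (x + y) = qZ x + qZ y" "qW (x + y) = qW x + qW y"
  "qZ (r *\<^sub>R x) = r *\<^sub>R qZ x" "qW (r *\<^sub>R x) = r *\<^sub>R qW x"
  "qZ (x * y) = qZ x * qZ y - qW x * cnj (qW y)"
  "qW (x * y) = qZ x * qW y + qW x * cnj (qZ y)"
  by (simp_all add: qZ_def qW_def quat_defs complex_eq_iff)

lemma splitting_carrier: "A \<in> carrier_mat n n \<Longrightarrow> splitting A \<in> carrier_mat (2 * n) (2 * n)"
  by (auto simp: splitting_def)

lemma splitting_one: "splitting (1\<^sub>m n) = 1\<^sub>m (2 * n)"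
  by (rule eq_matI) (auto simp: splitting_def quat_complex_parts)

lemma splitting_add:
  assumes "A \<in> carrier_mat n n" "B \<in> carrier_mat n n"
  shows "splitting (A + B) = splitting A + splitting B"
  using assms by (intro eq_matI) (auto simp: splitting_def quat_complex_parts)

lemma quat_parts_sum:
  "qZ (sum f S) = (\<Sum>i\<in>S. qZ (f i))" "qW (sum f S) = (\<Sum>i\<in>S. qW (f i))"
  by (induction S rule: infinite_finite_induct; simp add: quat_complex_parts)+

lemma splitting_mult:
  assumes A: "A \<in> carrier_mat n n" and B: "B \<in> carrier_mat n n"
  shows "splitting (A * B) = splitting A * splitting B"
proof -
  have "splitting A * splitting B = four_block_mat
      (map_mat qZ A * map_mat qZ B + map_mat qW A * (- map_mat (cnj \<circ> qW) B))
      (map_mat qZ A * map_mat qW B + map_mat qW A * map_mat (cnj \<circ> qZ) B)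
      ((- map_mat (cnj \<circ> qW) A) * map_mat qZ B + map_mat (cnj \<circ> qZ) A * (- map_mat (cnj \<circ> qW) B))
      ((- map_mat (cnj \<circ> qW) A) * map_mat qW B + map_mat (cnj \<circ> qZ) A * map_mat (cnj \<circ> qZ) B)"
    unfolding splitting_def using A B by (subst mult_four_block_mat[where ?nr1.0=n and ?n1.0=n
      and ?n2.0=n and ?nr2.0=n and ?nc1.0=n and ?nc2.0=n]) auto
  also have "\<dots> = splitting (A * B)"
    unfolding splitting_def
    by (rule arg_cong4[where f = four_block_mat]; rule eq_matI; insert A B)
      (auto simp: scalar_prod_def quat_parts_sum quat_complex_parts sum_subtractf sum.distrib
        sum_negf mult.commute algebra_simps)
  finally show ?thesis by simp
qed

lemma qZW_Quat: "qZ (Quat (Re z) (Im z) (Re w) (Im w)) = z" "qW (Quat (Re z) (Im z) (Re w) (Im w)) = w"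
  by (simp_all add: qZ_def qW_def)

lemma splitting_complexified_surj:
  assumes M: "M \<in> carrier_mat (2 * n) (2 * n)"
  obtains A B where "A \<in> carrier_mat n n" "B \<in> carrier_mat n n" "M = splitting A + \<i> \<cdot>\<^sub>m splitting B"
proof
  define q where "q z w = Quat (Re z) (Im z) (Re w) (Im w)" for z w
  have q: "qZ (q z w) = z" "qW (q z w) = w" for z w
    by (simp_all add: q_def qZW_Quat)
  define A where "A = mat n n (\<lambda>(r, c). q ((M $$ (r, c) + cnj (M $$ (r + n, c + n))) / 2)
    ((M $$ (r, c + n) - cnj (M $$ (r + n, c))) / 2))"
  define B where "B = mat n n (\<lambda>(r, c). q ((M $$ (r, c) - cnj (M $$ (r + n, c + n))) / (2 * \<i>))
    ((M $$ (r, c + n) + cnj (M $$ (r + n, c))) / (2 * \<i>)))"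
  show A: "A \<in> carrier_mat n n" and B: "B \<in> carrier_mat n n" by (simp_all add: A_def B_def)
  show "M = splitting A + \<i> \<cdot>\<^sub>m splitting B"
    using M by (intro eq_matI)
      (auto simp: splitting_def A_def B_def q field_simps)
qed

lemma splitting_complexified_inj:
  assumes "A \<in> carrier_mat n n" "B \<in> carrier_mat n n" "A' \<in> carrier_mat n n" "B' \<in> carrier_mat n n"
    and eq: "splitting A + \<i> \<cdot>\<^sub>m splitting B = splitting A' + \<i> \<cdot>\<^sub>m splitting B'"
  shows "A = A' \<and> B = B'"
proof -
  have "A $$ (r, c) = A' $$ (r, c) \<and> B $$ (r, c) = B' $$ (r, c)" if "r < n" "c < n" for r c
  proof -
    have e: "(splitting A + \<i> \<cdot>\<^sub>m splitting B) $$ (u, v) = (splitting A' + \<i> \<cdot>\<^sub>m splitting B') $$ (u, v)" for u v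
      by (simp only: eq)
    show ?thesis
      using e[of r c] e[of r "c + n"] e[of "r + n" c] e[of "r + n" "c + n"] assms(1-4) that
      by (simp add: splitting_def qZ_def qW_def quat_eq_iff complex_eq_iff)
  qed
  then show ?thesis using assms(1-4) by (auto intro!: eq_matI)
qed

section \<open>Special linear group and special linear Lie algebra\<close>

abbreviation mat_ring_H :: "nat \<Rightarrow> quat mat ring" where
  "mat_ring_H n \<equiv> ring_mat TYPE(quat) n ()"

definition GL_H :: "nat \<Rightarrow> quat mat set" where
  "GL_H n = Units (mat_ring_H n)"

definition SL_H :: "nat \<Rightarrow> quat mat set" where
  "SL_H n = {g \<in> GL_H n. Nrd g = 1}"

definition sl_H :: "nat \<Rightarrow> quat mat set" where
  "sl_H n = {z \<in> carrier_mat n n. Trd z = 0}"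

definition nilpotent_mat :: "'a :: semiring_1 mat \<Rightarrow> bool" where
  "nilpotent_mat X \<longleftrightarrow> (\<exists>k. X ^\<^sub>m k = 0\<^sub>m (dim_row X) (dim_row X))"

definition Ad_H :: "nat \<Rightarrow> quat mat \<Rightarrow> quat mat \<Rightarrow> quat mat" where
  "Ad_H n g X = g * X * inv\<^bsub>mat_ring_H n\<^esub> g"

text \<open>For a linear Lie group \<open>G\<close> of \<open>n\<close> by \<open>n\<close> quaternionic matrices.\<close>

definition strongly_Ad_real :: "nat \<Rightarrow> quat mat set \<Rightarrow> quat mat \<Rightarrow> bool" where
  "strongly_Ad_real n G X \<longleftrightarrow> (\<exists>\<tau>\<in>G. \<tau> * \<tau> = 1\<^sub>m n \<and> Ad_H n \<tau> X = - X)"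

end

theory Submission
  imports Defs
begin

text \<open>
  It suffices to find an idempotent $e$ with $eX + Xe = X$: then $\tau = 1 - 2e$ is an involution
  and $\tau X \tau = -X$. Such an $e$ exists for every nilpotent $X$ in a von Neumann regular ring,
  by induction on the nilpotency index: if $g$ is a generalized inverse of $X$ and $h = Xg$ the
  idempotent onto the image of $X$, the induction hypothesis for $Xh$ in the corner ring of $h$ gives
  a grading of the image, which is then extended to the whole space. Matrices over a division ring
  are von Neumann regular by Gaussian elimination, which also shows that every idempotent is
  conjugate to a diagonal matrix with entries $0$ and $1$. Hence $\tau$ is conjugate to a diagonal
  sign matrix $D$, and its reduced norm is $(\det D)^2 = 1$.
\<close>

section \<open>Nilpotent elements of von Neumann regular rings\<close>

context ring
begin

text \<open>Right-nesting by \<open>m_assoc\<close> hides the product \<open>a \<otimes> b\<close>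
  inside \<open>a \<otimes> (b \<otimes> z)\<close>; this form keeps the rewrite rule applicable
  there. The next lemma does the same for triple products.\<close>

lemma m_assoc_ext2:
  assumes "a \<otimes> b = c" "a \<in> carrier R" "b \<in> carrier R" "z \<in> carrier R"
  shows "a \<otimes> (b \<otimes> z) = c \<otimes> z"
  using assms by (simp add: m_assoc[symmetric])

lemma m_assoc_ext3:
  assumes "a \<otimes> (b \<otimes> c) = d" "a \<in> carrier R" "b \<in> carrier R" "c \<in> carrier R" "z \<in> carrier R"
  shows "a \<otimes> (b \<otimes> (c \<otimes> z)) = d \<otimes> z"
  using assms by (simp add: m_assoc[symmetric])

lemma a_minus_cancel:
  assumes "x \<in> carrier R" "y \<in> carrier R"
  shows "x \<oplus> y \<ominus> x = y" "x \<oplus> (y \<ominus> x) = y"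
proof -
  have "y \<oplus> x \<ominus> x = y" using assms by (simp add: minus_eq a_assoc r_neg)
  then show "x \<oplus> y \<ominus> x = y" "x \<oplus> (y \<ominus> x) = y"
    using assms by (simp_all add: a_comm minus_eq a_lcomm)
qed

text \<open>For a generalized inverse \<open>b0\<close> of \<open>a\<close>, the product
  \<open>b0 \<otimes> a \<otimes> b0\<close> is a reflexive one. Since \<open>p\<close> fixes
  \<open>a\<close> from the left and \<open>q\<close> from the right, cutting it down by
  \<open>q\<close> and \<open>p\<close> loses nothing.\<close>

lemma reflexive_inverse_in_corner:
  assumes a: "a \<in> carrier R" "p \<in> carrier R" "q \<in> carrier R"
    and pq: "p \<otimes> p = p" "q \<otimes> q = q" "p \<otimes> a = a" "a \<otimes> q = a"
    and reg: "\<exists>b\<in>carrier R. a \<otimes> b \<otimes> a = a"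
  obtains b where "b \<in> carrier R" "a \<otimes> b \<otimes> a = a" "b \<otimes> a \<otimes> b = b" "q \<otimes> b = b" "b \<otimes> p = b"
proof -
  obtain b0 where b0: "b0 \<in> carrier R" "a \<otimes> (b0 \<otimes> a) = a"
    using reg a by (auto simp: m_assoc)
  define b where "b = q \<otimes> b0 \<otimes> a \<otimes> b0 \<otimes> p"
  note ext = m_assoc_ext2[OF pq(1) a(2,2)] m_assoc_ext2[OF pq(2) a(3,3)] m_assoc_ext2[OF pq(3) a(2,1)]
    m_assoc_ext2[OF pq(4) a(1,3)] m_assoc_ext3[OF b0(2) a(1) b0(1) a(1)]
  show ?thesis
  proof
    show "b \<in> carrier R" "a \<otimes> b \<otimes> a = a" "b \<otimes> a \<otimes> b = b" "q \<otimes> b = b" "b \<otimes> p = b"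
      using a b0 pq by (simp_all add: b_def m_assoc ext)
  qed
qed

text \<open>\<open>E\<close> is sought with \<open>E \<otimes> X = e \<otimes> X\<close>, so that it
  extends the grading of the image, and with
  \<open>X \<otimes> E = (h \<ominus> e) \<otimes> X\<close>; the two sum to \<open>X\<close>. The
  second equation is solved by lifting the part \<open>h \<ominus> e\<close> of the image along
  \<open>X\<close>.\<close>

lemma odd_idempotent_step:
  assumes cl: "X \<in> carrier R" "f \<in> carrier R" "h \<in> carrier R" "e \<in> carrier R" "g \<in> carrier R"
    and f: "f \<otimes> g = g" "X \<otimes> f = X"
    and h: "X \<otimes> g = h" "h \<otimes> X = X" "h \<otimes> f = h" "f \<otimes> h = h"
    and e: "e \<otimes> e = e" "h \<otimes> e = e" "e \<otimes> h = e" "e \<otimes> (X \<otimes> h) \<oplus> X \<otimes> h \<otimes> e = X \<otimes> h"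
    and reg: "\<exists>b\<in>carrier R. X \<otimes> e \<otimes> b \<otimes> (X \<otimes> e) = X \<otimes> e"
  shows "\<exists>E\<in>carrier R. E \<otimes> E = E \<and> f \<otimes> E = E \<and> E \<otimes> f = E \<and> E \<otimes> X \<oplus> X \<otimes> E = X"
proof -
  have hh: "h \<otimes> h = h"
    using cl by (simp add: h(1)[symmetric] m_assoc_ext2[OF h(2)[folded h(1)]] m_assoc[symmetric])
       (simp add: h)
  \<comment> \<open>\<open>e\<close> and \<open>d\<close> split the image \<open>h\<close> of \<open>X\<close> into two parts that \<open>X\<close> interchanges.\<close>
  define d where "d = h \<ominus> e"
  have d: "d \<in> carrier R" "d \<otimes> d = d" "h \<otimes> d = d" "d \<otimes> h = d" "d \<otimes> e = \<zero>" "e \<otimes> d = \<zero>"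
    using cl hh e(1-3) by (simp_all add: d_def minus_eq l_distr r_distr l_minus r_minus r_neg)
  have hX: "h \<otimes> (X \<otimes> z) = X \<otimes> z" if "z \<in> carrier R" for z
    using cl h(2) that by (simp add: m_assoc[symmetric])
  have e4: "e \<otimes> (X \<otimes> h) \<oplus> X \<otimes> e = X \<otimes> h"
    using e cl by (simp add: m_assoc)
  have Xe: "X \<otimes> e = d \<otimes> (X \<otimes> h)"
  proof -
    have "X \<otimes> e = \<ominus> (e \<otimes> (X \<otimes> h)) \<oplus> (e \<otimes> (X \<otimes> h) \<oplus> X \<otimes> e)"
      using cl by (simp add: r_neg1)
    also have "\<dots> = d \<otimes> (X \<otimes> h)"
      unfolding e4 using cl by (simp add: d_def minus_eq l_distr hX l_minus a_comm)
    finally show ?thesis .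
  qed
  have dXe: "d \<otimes> (X \<otimes> e) = X \<otimes> e"
    using cl d by (simp add: Xe m_assoc_ext2[OF d(2)])
  have eXd: "e \<otimes> (X \<otimes> d) = X \<otimes> d"
    using arg_cong[OF e4, of "\<lambda>z. z \<otimes> d"] cl d e(1-3) by (simp add: l_distr m_assoc)
  have dXd: "d \<otimes> (X \<otimes> d) = \<zero>"
    using cl d by (subst eXd[symmetric]) (simp add: m_assoc_ext2[OF d(5)])
  have Xh: "X \<otimes> h = X \<otimes> d \<oplus> X \<otimes> e"
    using cl d by (simp add: d_def minus_eq r_distr r_minus a_assoc l_neg)
  \<comment> \<open>\<open>X \<otimes> e\<close> carries the \<open>e\<close>-part into the
    \<open>d\<close>-part; \<open>b\<close> is a generalized inverse leading back from
    \<open>d\<close> to \<open>e\<close>.\<close>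
  obtain b where b: "b \<in> carrier R" "X \<otimes> e \<otimes> b \<otimes> (X \<otimes> e) = X \<otimes> e" "b \<otimes> (X \<otimes> e) \<otimes> b = b"
     "e \<otimes> b = b" "b \<otimes> d = b"
    by (rule reflexive_inverse_in_corner[of "X \<otimes> e" d e])
      (use cl d(1,2) e(1) dXe reg in \<open>auto simp: m_assoc\<close>)
  note eb = m_assoc_ext2[OF b(4) cl(4) b(1)]
  have XbXe: "X \<otimes> (b \<otimes> (X \<otimes> e)) = X \<otimes> e"
    using b cl by (simp add: m_assoc eb)
  have bXb: "b \<otimes> (X \<otimes> b) = b"
    using b cl by (simp add: m_assoc)
  \<comment> \<open>Inside the \<open>d\<close>-part, \<open>q\<close> is the projection onto the
    image of \<open>X \<otimes> e\<close>.\<close>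
  define q where "q = X \<otimes> b"
  have "d \<otimes> q = X \<otimes> e \<otimes> b"
    using cl b(1) d(1) b(4)  m_assoc_ext3[OF dXe d(1) cl(1,4) b(1)]
    by (simp add: q_def m_assoc)
  then have q: "q \<in> carrier R" "d \<otimes> q = q" "q \<otimes> d = q" "q \<otimes> (X \<otimes> e) = X \<otimes> e" "h \<otimes> q = q"
    using cl b(1,4,5) d(1) XbXe h(2) by (simp_all add: q_def m_assoc hX)
  \<comment> \<open>The \<open>q\<close>-component of \<open>d\<close> is lifted along
    \<open>X\<close> by \<open>b\<close>; the generalized inverse \<open>g\<close> supplies a lift
    of the rest.\<close>
  define y0 where "y0 = g \<otimes> (d \<ominus> q)"
  have y0: "y0 \<in> carrier R" "X \<otimes> y0 = d \<ominus> q" "y0 \<otimes> d = y0" "f \<otimes> y0 = y0"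
    using cl q d f h(1)
    by (simp_all add: y0_def m_assoc m_assoc_ext2[OF h(1)] m_assoc_ext2[OF f(1)] minus_eq r_distr l_distr l_minus r_minus)
  \<comment> \<open>The correction keeps \<open>X y = d - q\<close> and achieves \<open>e y = b X e y\<close>, which makes \<open>E\<close> idempotent.\<close>
  define y where "y = y0 \<ominus> e \<otimes> y0 \<oplus> b \<otimes> (X \<otimes> (e \<otimes> y0))"
  have fe: "f \<otimes> e = e" "e \<otimes> f = e" using e h cl by (metis m_assoc)+
  have fb: "f \<otimes> b = b" using fe b(1,4) cl by (metis m_assoc)
  have yc: "y \<in> carrier R" using y0 cl b by (simp add: y_def)
  have XbXe': "X \<otimes> (b \<otimes> (X \<otimes> (e \<otimes> z))) = X \<otimes> (e \<otimes> z)" if "z \<in> carrier R" for z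
    using arg_cong[OF XbXe, of "\<lambda>x. x \<otimes> z"] cl b(1) that by (simp add: m_assoc)
  have bXb': "b \<otimes> (X \<otimes> (b \<otimes> z)) = b \<otimes> z" if "z \<in> carrier R" for z
    using arg_cong[OF bXb, of "\<lambda>x. x \<otimes> z"] cl b(1) that by (simp add: m_assoc)
  have ee: "e \<otimes> (e \<otimes> z) = e \<otimes> z" if "z \<in> carrier R" for z
    using cl e(1) that by (simp add: m_assoc[symmetric])
  have bd: "b \<otimes> (d \<otimes> z) = b \<otimes> z" if "z \<in> carrier R" for z
    using b(1,5) d(1) that by (simp add: m_assoc[symmetric])
  have Xy: "X \<otimes> y = d \<ominus> q"
    using y0 cl b(1) d(1) q(1)
    by (simp add: y_def minus_eq r_distr r_minus XbXe' a_assoc l_neg)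
  have ey: "e \<otimes> y = b \<otimes> (X \<otimes> (e \<otimes> y))"
  proof -
    have "e \<otimes> y = b \<otimes> (X \<otimes> (e \<otimes> y0))"
      using y0 cl b(1) by (simp add: y_def minus_eq r_distr r_minus ee eb r_neg)
    then show ?thesis
      using y0 cl b(1) by (simp add: bXb')
  qed
  have yd: "y \<otimes> d = y"
    using y0 cl b(1) d(1) by (simp add: y_def minus_eq l_distr l_minus m_assoc)
  \<comment> \<open>Both \<open>d\<close> and \<open>q\<close> kill
    \<open>X \<otimes> (d \<otimes> X)\<close> and fix \<open>X \<otimes> (e \<otimes> X)\<close>.
    They therefore agree on the sum \<open>X \<otimes> X\<close>, and \<open>y\<close> annihilates
    it.\<close>
  have dXX: "d \<otimes> (X \<otimes> X) = X \<otimes> (e \<otimes> X)" and qXX: "q \<otimes> (X \<otimes> X) = X \<otimes> (e \<otimes> X)"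
  proof -
    have XX: "X \<otimes> X = X \<otimes> (d \<otimes> X) \<oplus> X \<otimes> (e \<otimes> X)"
      using arg_cong[OF Xh, of "\<lambda>z. z \<otimes> X"] cl d(1) h(2) by (simp add: l_distr m_assoc)
    have dX: "d \<otimes> (X \<otimes> (d \<otimes> X)) = \<zero>" "d \<otimes> (X \<otimes> (e \<otimes> X)) = X \<otimes> (e \<otimes> X)"
        "q \<otimes> (X \<otimes> (e \<otimes> X)) = X \<otimes> (e \<otimes> X)"
      using arg_cong[OF dXd, of "\<lambda>z. z \<otimes> X"] arg_cong[OF dXe, of "\<lambda>z. z \<otimes> X"]
        arg_cong[OF q(4), of "\<lambda>z. z \<otimes> X"] cl d(1) q(1) by (simp_all add: m_assoc)
    then have "q \<otimes> (X \<otimes> (d \<otimes> X)) = \<zero>"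
      using cl d(1) q(1) by (metis m_assoc m_closed q(3) r_null)
    with dX show "d \<otimes> (X \<otimes> X) = X \<otimes> (e \<otimes> X)" "q \<otimes> (X \<otimes> X) = X \<otimes> (e \<otimes> X)"
      unfolding XX using cl d(1) q(1) by (simp_all add: r_distr)
  qed
  then have "(d \<ominus> q) \<otimes> (X \<otimes> X) = \<zero>"
    using cl d(1) q(1) by (simp add: minus_eq l_distr l_minus r_neg)
  then have "y0 \<otimes> (X \<otimes> X) = \<zero>"
    using cl d(1) q(1) by (simp add: y0_def m_assoc)
  then have yXX: "y \<otimes> (X \<otimes> X) = \<zero>"
    using cl y0 b(1) by (simp add: y_def minus_eq l_distr l_minus m_assoc)
  have fy: "f \<otimes> y = y"
    using y0 cl b(1) by (simp add: y_def minus_eq r_distr r_minus m_assoc_ext2[OF fb] m_assoc_ext2[OF fe(1)])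
  \<comment> \<open>The terms with \<open>b\<close> and \<open>y\<close> lift the components
    \<open>q\<close> and \<open>d \<ominus> q\<close> of \<open>d\<close>; subtracting
    \<open>b \<otimes> (X \<otimes> e)\<close> cancels the stray term \<open>X \<otimes> e\<close>
    in \<open>X \<otimes> E\<close>.\<close>
  define E where "E = e \<oplus> b \<otimes> X \<ominus> b \<otimes> (X \<otimes> e) \<oplus> y \<otimes> X"
  have E: "E \<in> carrier R" using cl b yc by (simp add: E_def)
  have XE: "X \<otimes> E = d \<otimes> X"
  proof -
    have "X \<otimes> E = X \<otimes> e \<oplus> q \<otimes> X \<ominus> X \<otimes> e \<oplus> (X \<otimes> y) \<otimes> X"
      using cl b(1) yc by (simp add: E_def q_def minus_eq r_distr r_minus m_assoc XbXe)
    also have "\<dots> = d \<otimes> X"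
      unfolding Xy using cl d(1) q(1) a_minus_cancel[of "X \<otimes> e" "q \<otimes> X"] a_minus_cancel(2)[of "q \<otimes> X" "d \<otimes> X"]
      by (simp add: minus_eq l_distr l_minus)
    finally show ?thesis .
  qed
  have EX: "E \<otimes> X = e \<otimes> X"
  proof -
    have "b \<otimes> (X \<otimes> X) = b \<otimes> (X \<otimes> (e \<otimes> X))"
      using bd[of "X \<otimes> X"] cl dXX by simp
    then show ?thesis
      using cl b(1) yc by (simp add: E_def minus_eq l_distr l_minus m_assoc yXX a_assoc r_neg)
  qed
  have "E \<otimes> E = E"
  proof -
    have eE: "e \<otimes> E = e \<oplus> b \<otimes> X \<ominus> b \<otimes> (X \<otimes> e) \<oplus> e \<otimes> (y \<otimes> X)"
      using cl b(1) yc by (simp add: E_def minus_eq r_distr r_minus e(1) eb)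
    \<comment> \<open>The condition on \<open>e \<otimes> y\<close> enters here: it makes the cross
      terms \<open>e \<otimes> (y \<otimes> X)\<close> in \<open>E \<otimes> E\<close>
      cancel.\<close>
    have "b \<otimes> (X \<otimes> (e \<otimes> (y \<otimes> X))) = e \<otimes> (y \<otimes> X)"
      using arg_cong[OF ey, of "\<lambda>z. z \<otimes> X"] cl b(1) yc by (simp add: m_assoc)
    then have bXeE: "b \<otimes> (X \<otimes> (e \<otimes> E)) = b \<otimes> X \<oplus> e \<otimes> (y \<otimes> X)"
      unfolding eE using cl b(1) yc a_minus_cancel(1)[of "b \<otimes> (X \<otimes> e)" "b \<otimes> X"]
      by (simp add: minus_eq r_distr r_minus bXb')
    have cancel: "s \<oplus> v \<oplus> u \<ominus> (u \<oplus> v) = s"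
      if "s \<in> carrier R" "v \<in> carrier R" "u \<in> carrier R" for s u v
      using that by (simp add: minus_eq a_assoc a_comm[of u v] r_neg)
    have "E \<otimes> E = e \<otimes> E \<oplus> b \<otimes> (X \<otimes> E) \<ominus> b \<otimes> (X \<otimes> (e \<otimes> E)) \<oplus> y \<otimes> (X \<otimes> E)"
      using cl b(1) yc E by (subst (1) E_def) (simp add: minus_eq l_distr l_minus m_assoc)
    also have "\<dots> = E"
      unfolding XE bXeE unfolding eE unfolding E_def using cl b(1) yc d(1)
        cancel[of "e \<oplus> b \<otimes> X \<ominus> b \<otimes> (X \<otimes> e)" "e \<otimes> (y \<otimes> X)" "b \<otimes> X"]
      by (simp add: bd m_assoc_ext2[OF yd])
    finally show ?thesis .
  qed
  moreover have "f \<otimes> E = E"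
    using cl b(1) yc by (simp add: E_def minus_eq r_distr r_minus fe
      m_assoc_ext2[OF fb] m_assoc_ext2[OF fy])
  moreover have "E \<otimes> f = E"
    using cl b(1) yc by (simp add: E_def minus_eq l_distr l_minus m_assoc fe f(2))
  moreover have "E \<otimes> X \<oplus> X \<otimes> E = X"
    using cl d h(2) a_minus_cancel(2)[of "e \<otimes> X" X]
    by (simp add: XE EX d_def minus_eq l_distr l_minus)
  ultimately show ?thesis using E by blast
qed

text \<open>
  The idempotent \<open>f\<close> is the unit of the corner ring in which \<open>X\<close> lives; it is needed for the
  induction, where \<open>X\<close> is restricted to its image.
\<close>
lemma nilpotent_odd_idempotent:
  assumes reg: "\<And>a. a \<in> carrier R \<Longrightarrow> \<exists>b\<in>carrier R. a \<otimes> b \<otimes> a = a"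
    and X: "X \<in> carrier R" and f: "f \<in> carrier R" "f \<otimes> f = f" "f \<otimes> X = X" "X \<otimes> f = X"
    and nil: "X [^] (k::nat) \<otimes> f = \<zero>"
  shows "\<exists>e\<in>carrier R. e \<otimes> e = e \<and> f \<otimes> e = e \<and> e \<otimes> f = e \<and> e \<otimes> X \<oplus> X \<otimes> e = X"
  using X f nil
proof (induction k arbitrary: X f)
  case 0
  \<comment> \<open>The zeroth power in the corner ring is its unit, so the hypothesis reads
    \<open>f = \<zero>\<close> and \<open>X = X \<otimes> f\<close> vanishes.\<close>
  then have "X = \<zero>" by (metis l_one l_null nat_pow_0 r_null)
  then show ?case using 0 by (intro bexI[of _ \<zero>]) auto
next
  case (Suc k)
  note cl = Suc.prems(1,2) and f = Suc.prems(3-5)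
  obtain g where g: "g \<in> carrier R" "X \<otimes> g \<otimes> X = X" "f \<otimes> g = g" "g \<otimes> f = g"
    by (rule reflexive_inverse_in_corner[OF cl(1,2,2) f(1,1,2,3) reg[OF cl(1)]])
  define h where "h = X \<otimes> g"
  have h: "h \<in> carrier R" "h \<otimes> X = X" "f \<otimes> h = h" "h \<otimes> f = h" "h \<otimes> h = h"
    using g cl f by (simp_all add: h_def m_assoc m_assoc_ext2[OF f(2)] m_assoc_ext3[OF g(2)[unfolded m_assoc[OF cl(1) g(1) cl(1)]]])
  \<comment> \<open>Inner factors \<open>h\<close> are absorbed because
    \<open>h \<otimes> X = X\<close>.\<close>
  have pow: "(X \<otimes> h) [^] j \<otimes> h = X [^] j \<otimes> h" for j :: nat
  proof (induction j)
    case (Suc j)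
    have "(X \<otimes> h) [^] Suc j \<otimes> h = ((X \<otimes> h) [^] j \<otimes> h) \<otimes> (X \<otimes> h)"
      using cl h by (simp add: m_assoc m_assoc_ext2[OF h(2)])
    also have "\<dots> = X [^] Suc j \<otimes> h"
      using cl h by (simp add: Suc m_assoc m_assoc_ext2[OF h(2)])
    finally show ?case .
  qed (use h in simp)
  \<comment> \<open>Multiplication by \<open>g\<close> turns the last factor \<open>X\<close> into
    \<open>h\<close>, so the exponent drops to \<open>k\<close>.\<close>
  have "X [^] Suc k \<otimes> f \<otimes> g = \<zero>"
    using Suc.prems(6) g by simp
  then have "X [^] k \<otimes> h = \<zero>"
    using cl g by (simp add: h_def m_assoc)
  then have nil: "(X \<otimes> h) [^] k \<otimes> h = \<zero>" using pow by simp
  have Xh: "X \<otimes> h \<in> carrier R" "h \<otimes> (X \<otimes> h) = X \<otimes> h" "X \<otimes> h \<otimes> h = X \<otimes> h"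
    using cl h(1,5) m_assoc_ext2[OF h(2,1) cl(1)] by (simp_all add: m_assoc)
  obtain e where e: "e \<in> carrier R" "e \<otimes> e = e" "h \<otimes> e = e" "e \<otimes> h = e"
      "e \<otimes> (X \<otimes> h) \<oplus> X \<otimes> h \<otimes> e = X \<otimes> h"
    using Suc.IH[OF Xh(1) h(1,5) Xh(2,3) nil] by blast
  show ?case
    by (rule odd_idempotent_step[of X f h e g]) (use cl f g h e reg h_def in simp_all)
qed

text \<open>\<open>P \<otimes> e \<otimes> Q\<close> and
  \<open>P \<otimes> e \<otimes> inv P\<close> generate the same right ideal, as \<open>Q\<close>
  and \<open>inv P\<close> are units. Idempotents with this property are conjugate, which upgrades
  equivalence to conjugacy.\<close>

lemma idempotent_conjugate:
  assumes cl: "e \<in> carrier R" "P \<in> Units R" "Q \<in> Units R"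
    and e: "e \<otimes> e = e" and N: "P \<otimes> e \<otimes> Q \<otimes> (P \<otimes> e \<otimes> Q) = P \<otimes> e \<otimes> Q"
  obtains H K where "H \<in> carrier R" "K \<in> carrier R" "H \<otimes> K = \<one>" "K \<otimes> H = \<one>"
    "e = K \<otimes> (P \<otimes> e \<otimes> Q) \<otimes> H"
proof -
  define N where "N = P \<otimes> e \<otimes> Q"
  define e' where "e' = P \<otimes> e \<otimes> inv P"
  note c = cl(1) cl(2,3)[THEN Units_closed] cl(2,3)[THEN Units_inv_closed]
  have c': "N \<in> carrier R" "e' \<in> carrier R" using c by (simp_all add: N_def e'_def)
  have NN: "N \<otimes> N = N" using N by (simp add: N_def)
  have PP: "inv P \<otimes> (P \<otimes> z) = z" "P \<otimes> (inv P \<otimes> z) = z" if "z \<in> carrier R" for z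
    using that cl c by (simp_all add: m_assoc[symmetric])
  have e'N: "e' \<otimes> N = N"
    using c by (simp add: N_def e'_def m_assoc PP m_assoc_ext2[OF e])
  \<comment> \<open>Since \<open>N \<otimes> inv Q = P \<otimes> e\<close>, idempotency of
    \<open>N\<close> says that \<open>N\<close> fixes \<open>P \<otimes> e\<close>.\<close>
  have "N \<otimes> N \<otimes> inv Q = N \<otimes> inv Q" by (simp add: NN)
  then have "N \<otimes> (P \<otimes> e) = P \<otimes> e"
    using c c' cl by (simp add: m_assoc) (simp add: N_def m_assoc cl)
  then have Ne': "N \<otimes> e' = e'"
    using c c' by (simp add: e'_def m_assoc[symmetric])
  \<comment> \<open>\<open>N\<close> and \<open>e'\<close> have the same image, so their difference squares to zero and conjugates one into the other.\<close>
  define w where "w = e' \<ominus> N"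
  have w: "w \<in> carrier R" "N \<otimes> w = w" "w \<otimes> N = \<zero>"
    using c' NN Ne' e'N by (simp_all add: w_def minus_eq l_distr r_distr l_minus r_minus r_neg)
  have ww: "w \<otimes> w = \<zero>"
    using m_assoc[of w N w] w c' by simp
  have inv1: "(\<one> \<ominus> w) \<otimes> (\<one> \<oplus> w) = \<one>" "(\<one> \<oplus> w) \<otimes> (\<one> \<ominus> w) = \<one>"
    using w by (simp_all add: minus_eq l_distr r_distr l_minus r_minus ww a_assoc r_neg l_neg)
  have conj: "(\<one> \<ominus> w) \<otimes> (N \<otimes> (\<one> \<oplus> w)) = e'"
  proof -
    have "(\<one> \<ominus> w) \<otimes> (N \<otimes> (\<one> \<oplus> w)) = N \<oplus> w"
      using w c' by (simp add: minus_eq l_distr r_distr l_minus r_minus ww)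
    also have "\<dots> = e'"
      using c' by (simp add: w_def a_minus_cancel)
    finally show ?thesis .
  qed
  show ?thesis
  proof
    show "(\<one> \<oplus> w) \<otimes> P \<in> carrier R" "inv P \<otimes> (\<one> \<ominus> w) \<in> carrier R" using c w by simp_all
    show "(\<one> \<oplus> w) \<otimes> P \<otimes> (inv P \<otimes> (\<one> \<ominus> w)) = \<one>"
      using c w inv1 by (simp add: m_assoc PP)
    show "inv P \<otimes> (\<one> \<ominus> w) \<otimes> ((\<one> \<oplus> w) \<otimes> P) = \<one>"
      using c w cl by (simp add: m_assoc m_assoc_ext2[OF inv1(1)])
    have "inv P \<otimes> (\<one> \<ominus> w) \<otimes> N \<otimes> ((\<one> \<oplus> w) \<otimes> P) = inv P \<otimes> ((\<one> \<ominus> w) \<otimes> (N \<otimes> (\<one> \<oplus> w))) \<otimes> P"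
      using c c' w by (simp add: m_assoc)
    also have "\<dots> = e"
      unfolding conj using c cl by (simp add: e'_def m_assoc PP)
    finally show "e = inv P \<otimes> (\<one> \<ominus> w) \<otimes> (P \<otimes> e \<otimes> Q) \<otimes> ((\<one> \<oplus> w) \<otimes> P)"
      by (simp add: N_def)
  qed
qed

section \<open>Reflections attached to idempotents\<close>

lemma reflection_of_idempotent:
  assumes e: "e \<in> carrier R" "e \<otimes> e = e"
  shows "(\<one> \<ominus> (e \<oplus> e)) \<otimes> (\<one> \<ominus> (e \<oplus> e)) = \<one>"
proof -
  define u where "u = e \<oplus> e"
  have u: "u \<in> carrier R" "u \<otimes> u = u \<oplus> u"
    using e by (simp_all add: u_def l_distr r_distr)
  then have "(\<one> \<ominus> u) \<otimes> (\<one> \<ominus> u) = \<one>"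
    by (simp add: minus_eq l_distr r_distr l_minus r_minus minus_add a_assoc r_neg1 r_neg2 l_neg)
  then show ?thesis by (simp add: u_def)
qed

text \<open>Multiplying \<open>odd\<close> by \<open>e\<close> gives
  \<open>e \<otimes> (X \<otimes> e) = \<zero>\<close>, so the expansion only subtracts
  \<open>e \<otimes> X \<oplus> X \<otimes> e = X\<close> twice from \<open>X\<close>.\<close>

lemma reflection_negates_odd:
  assumes cl: "e \<in> carrier R" "X \<in> carrier R"
    and e: "e \<otimes> e = e" and odd: "e \<otimes> X \<oplus> X \<otimes> e = X"
  shows "(\<one> \<ominus> (e \<oplus> e)) \<otimes> X \<otimes> (\<one> \<ominus> (e \<oplus> e)) = \<ominus> X"
proof -
  have "e \<otimes> X = e \<otimes> (e \<otimes> X \<oplus> X \<otimes> e)" by (simp add: odd)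
  also have "\<dots> = e \<otimes> X \<oplus> e \<otimes> (X \<otimes> e)"
    using cl by (simp add: r_distr m_assoc_ext2[OF e])
  finally have "e \<otimes> X \<oplus> e \<otimes> (X \<otimes> e) = e \<otimes> X \<oplus> \<zero>" using cl by simp
  then have eXe: "e \<otimes> (X \<otimes> e) = \<zero>"
    using cl by (metis m_closed r_neg1 zero_closed)
  have "(\<one> \<ominus> (e \<oplus> e)) \<otimes> X \<otimes> (\<one> \<ominus> (e \<oplus> e)) = X \<ominus> (e \<otimes> X \<oplus> X \<otimes> e) \<ominus> (e \<otimes> X \<oplus> X \<otimes> e)"
    using cl by (simp add: minus_eq l_distr r_distr l_minus r_minus minus_add m_assoc eXe a_ac)
  also have "\<dots> = \<ominus> X"
    unfolding odd using cl by (simp add: minus_eq r_neg)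
  finally show ?thesis .
qed

end

section \<open>Diagonalization of matrices over division rings\<close>

lemma ring_mat_ring_1: "ring (ring_mat TYPE('a :: ring_1) n b)"
  by (unfold_locales, insert add_inv_exists_mat, auto simp: ring_mat_def algebra_simps Units_def)

text \<open>Multiplying by such a matrix from the left performs all row operations with pivot row
  \<open>k\<close> at once, with coefficients on the left. Its row counterpart acts on columns from
  the right; the sides matter because entries need not commute.\<close>

definition col_replace_mat :: "nat \<Rightarrow> nat \<Rightarrow> (nat \<Rightarrow> 'a :: semiring_1) \<Rightarrow> 'a mat" where
  "col_replace_mat n k x = mat n n (\<lambda>(i, j). if j = k then x i else if i = j then 1 else 0)"

definition row_replace_mat :: "nat \<Rightarrow> nat \<Rightarrow> (nat \<Rightarrow> 'a :: semiring_1) \<Rightarrow> 'a mat" where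
  "row_replace_mat n k y = mat n n (\<lambda>(i, j). if i = k then y j else if i = j then 1 else 0)"

lemma replace_mat_carrier [simp]:
  "col_replace_mat n k x \<in> carrier_mat n n" "row_replace_mat n k x \<in> carrier_mat n n"
  by (simp_all add: col_replace_mat_def row_replace_mat_def)

lemma col_replace_mat_mult:
  assumes "A \<in> carrier_mat n n" "k < n" "i < n" "j < n"
  shows "(col_replace_mat n k x * A) $$ (i, j) = x i * A $$ (k, j) + (if i = k then 0 else A $$ (i, j))"
proof -
  have "(col_replace_mat n k x * A) $$ (i, j) = (\<Sum>l\<in>{0..<n}. col_replace_mat n k x $$ (i, l) * A $$ (l, j))"
    using assms carrier_matD[OF replace_mat_carrier(1), of n k x] by (simp add: scalar_prod_def)
  also have "\<dots> = (\<Sum>l\<in>{0..<n}. (if l = k then x i * A $$ (k, j) else 0) + (if l = i then if i = k then 0 else A $$ (i, j) else 0))"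
    using assms by (intro sum.cong refl) (auto simp: col_replace_mat_def)
  also have "\<dots> = x i * A $$ (k, j) + (if i = k then 0 else A $$ (i, j))"
    using assms by (simp add: sum.distrib)
  finally show ?thesis .
qed

lemma row_replace_mat_mult:
  assumes "A \<in> carrier_mat n n" "k < n" "i < n" "j < n"
  shows "(A * row_replace_mat n k y) $$ (i, j) = A $$ (i, k) * y j + (if j = k then 0 else A $$ (i, j))"
proof -
  have "(A * row_replace_mat n k y) $$ (i, j) = (\<Sum>l\<in>{0..<n}. A $$ (i, l) * row_replace_mat n k y $$ (l, j))"
    using assms carrier_matD[OF replace_mat_carrier(2), of n k y] by (simp add: scalar_prod_def)
  also have "\<dots> = (\<Sum>l\<in>{0..<n}. (if l = k then A $$ (i, k) * y j else 0) + (if l = j then if j = k then 0 else A $$ (i, j) else 0))"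
    using assms by (intro sum.cong refl) (auto simp: row_replace_mat_def)
  also have "\<dots> = A $$ (i, k) * y j + (if j = k then 0 else A $$ (i, j))"
    using assms by (simp add: sum.distrib)
  finally show ?thesis .
qed

lemma col_replace_mat_Unit:
  fixes x :: "nat \<Rightarrow> 'a :: division_ring"
  assumes "k < n" "x k \<noteq> 0"
  shows "col_replace_mat n k x \<in> Units (ring_mat TYPE('a) n b)"
proof -
  \<comment> \<open>The inverse has the same shape: \<open>x'\<close> solves
    \<open>x k * x' k = 1\<close> and \<open>x i * x' k + x' i = 0\<close> for
    \<open>i \<noteq> k\<close>.\<close>
  define x' where "x' i = (if i = k then inverse (x k) else - x i * inverse (x k))" for i
  have "col_replace_mat n k x * col_replace_mat n k x' = 1\<^sub>m n"
    "col_replace_mat n k x' * col_replace_mat n k x = 1\<^sub>m n"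
    using assms by (auto intro!: eq_matI simp: col_replace_mat_mult simp del: index_mult_mat)
      (auto simp: col_replace_mat_def x'_def mult.assoc)
  then show ?thesis
    unfolding Units_def by (auto simp: ring_mat_simps intro!: bexI[of _ "col_replace_mat n k x'"])
qed

lemma row_replace_mat_Unit:
  fixes y :: "nat \<Rightarrow> 'a :: division_ring"
  assumes "k < n" "y k \<noteq> 0"
  shows "row_replace_mat n k y \<in> Units (ring_mat TYPE('a) n b)"
proof -
  define y' where "y' j = (if j = k then inverse (y k) else - inverse (y k) * y j)" for j
  have "row_replace_mat n k y * row_replace_mat n k y' = 1\<^sub>m n"
    "row_replace_mat n k y' * row_replace_mat n k y = 1\<^sub>m n"
    using assms by (auto intro!: eq_matI simp: row_replace_mat_mult simp del: index_mult_mat)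
      (auto simp: row_replace_mat_def y'_def mult.assoc[symmetric])
  then show ?thesis
    unfolding Units_def by (auto simp: ring_mat_simps intro!: bexI[of _ "row_replace_mat n k y'"])
qed

section \<open>Pivoting and Gaussian elimination\<close>

lemma swaprows_mat_mult_left:
  assumes "A \<in> carrier_mat n n" "k < n" "l < n" "i < n" "j < n"
  shows "(swaprows_mat n k l * A) $$ (i, j) = A $$ (if i = k then l else if i = l then k else i, j)"
  using assms by (subst swaprows_mat[symmetric]) auto

lemma swaprows_mat_mult_right:
  assumes "A \<in> carrier_mat n n" "k < n" "l < n" "i < n" "j < n"
  shows "(A * swaprows_mat n k l) $$ (i, j) = A $$ (i, if j = k then l else if j = l then k else j)"
proof -
  have "(A * swaprows_mat n k l) $$ (i, j) = (\<Sum>m\<in>{0..<n}. A $$ (i, m) * swaprows_mat n k l $$ (m, j))"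
    using assms by (simp add: scalar_prod_def)
  also have "\<dots> = (\<Sum>m\<in>{0..<n}. if m = (if j = k then l else if j = l then k else j) then A $$ (i, m) else 0)"
    using assms by (intro sum.cong refl) auto
  finally show ?thesis using assms by auto
qed

text \<open>The shape after \<open>k\<close> rounds of elimination: a diagonal block of size
  \<open>k\<close> with entries 0 and 1, zeros to its right and below it, and an arbitrary remaining
  block.\<close>

definition diag01_upto :: "nat \<Rightarrow> 'a :: {zero, one} mat \<Rightarrow> bool" where
  "diag01_upto k N \<longleftrightarrow> (\<forall>i<dim_row N. \<forall>j<dim_row N. i < k \<or> j < k \<longrightarrow> (if i = j then N $$ (i, j) \<in> {0, 1} else N $$ (i, j) = 0))"

lemma diag01_equivalent_upto:
  fixes A :: "'a :: division_ring mat"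
  assumes A: "A \<in> carrier_mat n n" and "k \<le> n"
  shows "\<exists>P\<in>Units (ring_mat TYPE('a) n b). \<exists>Q\<in>Units (ring_mat TYPE('a) n b). diag01_upto k (P * A * Q)"
  using \<open>k \<le> n\<close>
proof (induction k)
  case 0
  interpret ring "ring_mat TYPE('a) n b" by (rule ring_mat_ring_1)
  show ?case using Units_one_closed by (auto simp: diag01_upto_def ring_mat_simps)
next
  case (Suc k)
  interpret ring "ring_mat TYPE('a) n b" by (rule ring_mat_ring_1)
  let ?U = "Units (ring_mat TYPE('a) n b)"
  have U_mult: "P * Q \<in> ?U" if "P \<in> ?U" "Q \<in> ?U" for P Q
    using Units_m_closed[OF that] by (simp add: ring_mat_simps)
  have U_carrier: "P \<in> carrier_mat n n" if "P \<in> ?U" for P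
    using Units_closed[OF that] by (simp add: ring_mat_simps)
  have k: "k < n" using Suc by simp
  from Suc obtain P Q where PQ: "P \<in> ?U" "Q \<in> ?U" and N: "diag01_upto k (P * A * Q)" by auto
  note c = U_carrier[OF PQ(1)] U_carrier[OF PQ(2)]
  define N where "N = P * A * Q"
  have Nc: "N \<in> carrier_mat n n" using c A by (simp add: N_def)
  have Nk: "if i = j then N $$ (i, j) \<in> {0, 1} else N $$ (i, j) = 0" if "i < n" "j < n" "i < k \<or> j < k" for i j
    using N that Nc unfolding N_def[symmetric] diag01_upto_def by blast
  show ?case
  proof (cases "\<forall>i<n. \<forall>j<n. k \<le> i \<and> k \<le> j \<longrightarrow> N $$ (i, j) = 0")
    case True
    \<comment> \<open>No pivot is left: the remaining block is zero, so \<open>N\<close> already has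
      the next shape.\<close>
    have "diag01_upto (Suc k) N"
      unfolding diag01_upto_def
    proof (intro allI impI)
      fix i j assume "i < dim_row N" "j < dim_row N" "i < Suc k \<or> j < Suc k"
      then show "if i = j then N $$ (i, j) \<in> {0, 1} else N $$ (i, j) = 0"
        using Nk[of i j] True Nc by (cases "i < k \<or> j < k") auto
    qed
    then show ?thesis using PQ by (auto simp: N_def)
  next
    case False
    then obtain r s where rs: "r < n" "s < n" "k \<le> r" "k \<le> s" "N $$ (r, s) \<noteq> 0" by auto
    define S T where "S = (swaprows_mat n k r :: 'a mat)" and "T = (swaprows_mat n k s :: 'a mat)"
    have ST: "S \<in> ?U" "T \<in> ?U" using k rs by (auto simp: S_def T_def swaprows_mat_Unit)
    note ST_carrier = U_carrier[OF ST(1)] U_carrier[OF ST(2)]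
    define M where "M = S * N * T"
    have M: "M $$ (i, j) = N $$ (if i = k then r else if i = r then k else i, if j = k then s else if j = s then k else j)"
      if "i < n" "j < n" for i j
      unfolding M_def S_def T_def using that Nc k rs
      by (subst swaprows_mat_mult_right) (auto simp: swaprows_mat_mult_left simp del: index_mult_mat(1))
    have Mc: "M \<in> carrier_mat n n" using ST_carrier Nc by (simp add: M_def)
    define c where "c = M $$ (k, k)"
    have c: "c \<noteq> 0" using M[of k k] rs k by (auto simp: c_def)
    \<comment> \<open>\<open>L\<close> scales the pivot to 1 and clears the rest of column
      \<open>k\<close>; \<open>R\<close> then clears the rest of row \<open>k\<close>. What remains
      is the Schur complement of \<open>c\<close>.\<close>
    define L where "L = col_replace_mat n k (\<lambda>i. if i = k then inverse c else - M $$ (i, k) * inverse c)"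
    define R where "R = row_replace_mat n k (\<lambda>j. if j = k then 1 else - inverse c * M $$ (k, j))"
    have LR: "L \<in> ?U" "R \<in> ?U" using k c by (auto simp: L_def R_def intro!: col_replace_mat_Unit row_replace_mat_Unit)
    note LRc = U_carrier[OF LR(1)] U_carrier[OF LR(2)]
    define D where "D = L * M * R"
    have Dc: "D \<in> carrier_mat n n" using LRc Mc by (simp add: D_def)
    have LM: "(L * M) $$ (i, j) = (if i = k then inverse c * M $$ (k, j) else M $$ (i, j) - M $$ (i, k) * inverse c * M $$ (k, j))"
      if "i < n" "j < n" for i j
      unfolding L_def using that k Mc by (simp add: col_replace_mat_mult mult.assoc del: index_mult_mat(1))
    have D: "D $$ (i, j) = (if i = k then if j = k then 1 else 0 else if j = k then 0
        else M $$ (i, j) - M $$ (i, k) * inverse c * M $$ (k, j))"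
      if "i < n" "j < n" for i j
      unfolding D_def R_def using that k Mc LRc c
      by (simp add: row_replace_mat_mult LM mult.assoc del: index_mult_mat(1)) (simp add: c_def mult.assoc[symmetric])
    \<comment> \<open>The swaps move only indices from \<open>k\<close> on, so finished rows and
      columns stay finished.\<close>
    have Mk: "if i = j then M $$ (i, j) \<in> {0, 1} else M $$ (i, j) = 0" if "i < n" "j < n" "i < k \<or> j < k" for i j
      using M[of i j] that Nk[of i j] Nk[of i s] Nk[of i k] Nk[of r j] Nk[of k j] rs k by (auto split: if_splits)
    have "diag01_upto (Suc k) D"
      unfolding diag01_upto_def
    proof (intro allI impI)
      fix i j assume "i < dim_row D" "j < dim_row D" "i < Suc k \<or> j < Suc k"
      then show "if i = j then D $$ (i, j) \<in> {0, 1} else D $$ (i, j) = 0"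
        using Mk[of i j] Mk[of i k] Mk[of k j] D[of i j] Dc k by (auto split: if_splits)
    qed
    moreover have "D = (L * S * P) * A * (Q * T * R)"
      using A U_carrier[OF PQ(1)] U_carrier[OF PQ(2)] ST_carrier LRc
      by (simp add: D_def M_def N_def assoc_mult_mat[of _ n n _ n _ n])
    ultimately show ?thesis using U_mult PQ ST LR by metis
  qed
qed

section \<open>Diagonal form and von Neumann regularity\<close>

lemma a_inv_ring_mat:
  fixes A :: "'a :: ring_1 mat"
  assumes "A \<in> carrier_mat n n"
  shows "\<ominus>\<^bsub>ring_mat TYPE('a) n b\<^esub> A = - A"
proof -
  interpret ring "ring_mat TYPE('a) n b" by (rule ring_mat_ring_1)
  show ?thesis
    by (rule minus_equality) (use assms in \<open>simp_all add: ring_mat_simps\<close>)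
qed

lemma diagonal_form:
  fixes A :: "'a :: division_ring mat"
  assumes "A \<in> carrier_mat n n"
  obtains P Q f where "P \<in> Units (ring_mat TYPE('a) n b)" "Q \<in> Units (ring_mat TYPE('a) n b)"
    "P * A * Q = mat_diag n f" "\<And>i. f i \<in> {0, 1}"
proof -
  obtain P Q where PQ: "P \<in> Units (ring_mat TYPE('a) n b)" "Q \<in> Units (ring_mat TYPE('a) n b)"
      and D: "diag01_upto n (P * A * Q)"
    using diag01_equivalent_upto[OF assms order_refl, of b] by (elim bexE)
  define N where "N = P * A * Q"
  interpret ring "ring_mat TYPE('a) n b" by (rule ring_mat_ring_1)
  have N: "N \<in> carrier_mat n n"
    using PQ[THEN Units_closed] assms by (simp add: N_def ring_mat_simps)
  have entry: "if i = j then N $$ (i, j) \<in> {0, 1} else N $$ (i, j) = 0" if "i < n" "j < n" for i j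
    using D that N unfolding N_def[symmetric] diag01_upto_def by blast
  \<comment> \<open>The default 0 makes \<open>f i \<in> {0, 1}\<close> hold for indices outside the
    matrix as well.\<close>
  define f where "f i = (if i < n then N $$ (i, i) else 0)" for i
  have "f i \<in> {0, 1}" for i using entry[of i i] by (simp add: f_def)
  moreover have "N = mat_diag n f"
  proof (rule eq_matI)
    show "N $$ (i, j) = mat_diag n f $$ (i, j)"
      if "i < dim_row (mat_diag n f)" "j < dim_col (mat_diag n f)" for i j
      using entry[of i j] that by (simp add: mat_diag_def f_def split: if_splits)
  qed (use N in \<open>simp_all add: mat_diag_def\<close>)
  ultimately show ?thesis using that[OF PQ] by (simp add: N_def)
qed

text \<open>The diagonal form \<open>P * A * Q\<close> is idempotent; cancelling the outer units in
  that equation shows that \<open>Q * P\<close> is a generalized inverse.\<close>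

lemma mat_von_Neumann_regular:
  fixes A :: "'a :: division_ring mat"
  assumes A: "A \<in> carrier_mat n n"
  shows "\<exists>B\<in>carrier_mat n n. A * B * A = A"
proof -
  interpret ring "ring_mat TYPE('a) n ()" by (rule ring_mat_ring_1)
  let ?inv = "m_inv (ring_mat TYPE('a) n ())"
  obtain P Q f where PQ: "P \<in> Units (ring_mat TYPE('a) n ())" "Q \<in> Units (ring_mat TYPE('a) n ())"
      and N: "P * A * Q = mat_diag n f" and f: "\<And>i. f i \<in> {0, 1}"
    using diagonal_form[OF A] by metis
  have c: "P \<in> carrier_mat n n" "Q \<in> carrier_mat n n" "?inv P \<in> carrier_mat n n" "?inv Q \<in> carrier_mat n n"
    using PQ[THEN Units_closed] PQ[THEN Units_inv_closed] by (simp_all add: ring_mat_simps)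
  note [simp] = assoc_mult_mat[of _ n n _ n _ n]
  have inv: "?inv P * P = 1\<^sub>m n" "Q * ?inv Q = 1\<^sub>m n"
    using Units_l_inv[OF PQ(1)] Units_r_inv[OF PQ(2)] by (simp_all add: ring_mat_simps)
  have inv': "?inv P * (P * Z) = Z" "Q * (?inv Q * Z) = Z" if "Z \<in> carrier_mat n n" for Z
    using c that inv by (simp_all flip: assoc_mult_mat[of _ n n _ n _ n])
  have "f i * f i = f i" for i using f[of i] by auto
  then have NN: "mat_diag n f * mat_diag n f = mat_diag n f" by (simp only: mat_diag_diag)
  then have "?inv P * (P * A * Q * (P * A * Q)) * ?inv Q = ?inv P * (P * A * Q) * ?inv Q"
    by (simp only: N)
  then have "A * (Q * P) * A = A"
    using A c by (simp add: inv inv')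
  then show ?thesis using c by (intro bexI[of _ "Q * P"]) auto
qed

section \<open>Reduced norm of involutions\<close>

lemma Nrd_mult:
  assumes "A \<in> carrier_mat n n" "B \<in> carrier_mat n n"
  shows "Nrd (A * B) = Nrd A * Nrd B"
  using assms by (simp add: Nrd_def splitting_mult det_mult[OF splitting_carrier splitting_carrier])

text \<open>The entries are real, so the splitting consists of two diagonal copies of the same sign
  matrix. The reduced norm is thus the square of a determinant, whatever the number of negative
  signs.\<close>

lemma Nrd_diag_signs:
  assumes s: "\<And>i. s i \<in> {1, - 1}"
  shows "Nrd (mat_diag n s) = 1"
proof -
  define D where "D = mat_diag n (\<lambda>i. qZ (s i))"
  have D: "D \<in> carrier_mat n n" by (simp add: D_def)
  have q: "qW (s i) = 0" "cnj (qZ (s i)) = qZ (s i)" "qZ (s i) * qZ (s i) = 1" for i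
    using s[of i] by (auto simp: qZ_def qW_def quat_defs complex_eq_iff)
  have "splitting (mat_diag n s) = four_block_mat D (0\<^sub>m n n) (0\<^sub>m n n) D"
    unfolding splitting_def
    by (rule arg_cong4[where f = four_block_mat]; rule eq_matI)
      (auto simp: D_def mat_diag_def q quat_complex_parts)
  then have "Nrd (mat_diag n s) = det D * det D"
    using det_four_block_mat_upper_right_zero[OF D refl zero_carrier_mat D] by (simp add: Nrd_def)
  also have "\<dots> = det (D * D)" using det_mult[OF D D] by simp
  also have "D * D = 1\<^sub>m n" by (simp add: D_def q)
  finally show ?thesis by simp
qed

lemma Nrd_reflection_of_idempotent:
  fixes R (structure) and n :: nat
  defines "R \<equiv> mat_ring_H n"
  assumes e: "e \<in> carrier_mat n n" "e * e = e"
  shows "Nrd (\<one> \<ominus> (e \<oplus> e)) = 1"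
proof -
  interpret ring R unfolding R_def by (rule ring_mat_ring_1)
  note simps = ring_mat_simps[where ty = "TYPE(quat)" and n = n and b = "()", folded R_def]
  obtain P Q f where PQ: "P \<in> Units R" "Q \<in> Units R"
      and N: "P * e * Q = mat_diag n f" and f: "\<And>i. f i \<in> {0, 1}"
    using diagonal_form[OF e(1)] unfolding R_def by metis
  \<comment> \<open>The diagonal form is idempotent too, so the equivalence of \<open>e\<close> with
    it can be strengthened to conjugacy.\<close>
  have "f i * f i = f i" for i using f[of i] by auto
  then have "mat_diag n f * mat_diag n f = mat_diag n f" by (simp only: mat_diag_diag)
  then obtain H K where HK: "H \<in> carrier R" "K \<in> carrier R" "H \<otimes> K = \<one>" "K \<otimes> H = \<one>"
      and eK: "e = K \<otimes> mat_diag n f \<otimes> H"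
    using idempotent_conjugate[of e P Q] e PQ N by (auto simp: simps)
  let ?N = "mat_diag n f"
  have Nc: "?N \<in> carrier R" by (simp add: simps)
  define T where "T = \<one> \<ominus> (?N \<oplus> ?N)"
  have Tc: "T \<in> carrier R" using Nc by (simp add: T_def)
  have "\<one> \<ominus> (e \<oplus> e) = K \<otimes> T \<otimes> H"
    using HK Nc unfolding eK T_def by (simp add: minus_eq l_distr r_distr l_minus r_minus minus_add)
  then have "Nrd (\<one> \<ominus> (e \<oplus> e)) = Nrd K * Nrd T * Nrd H"
    using HK Tc by (simp add: simps Nrd_mult[of _ n] mult_carrier_mat[of _ n n])
  \<comment> \<open>Reduced norms are complex numbers and commute although the matrices need not, so
    \<open>H\<close> and \<open>K\<close> can be brought together.\<close>
  also have "Nrd K * Nrd T * Nrd H = Nrd T * Nrd (H * K)"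
    using HK Nrd_mult[of H n K] by (simp add: simps)
  also have "Nrd (H * K) = 1"
    using HK(3) by (simp add: simps Nrd_def splitting_one)
  finally have "Nrd (\<one> \<ominus> (e \<oplus> e)) = Nrd T" by simp
  moreover have "T = mat_diag n (\<lambda>i. 1 - (f i + f i))"
    using Nc a_inv_ring_mat[of "?N + ?N" n "()"] unfolding T_def
    by (auto simp: minus_eq simps R_def[symmetric] mat_diag_def intro!: eq_matI)
  moreover have "Nrd (mat_diag n (\<lambda>i. 1 - (f i + f i))) = 1"
  proof (rule Nrd_diag_signs)
    show "1 - (f i + f i) \<in> {1, - 1}" for i using f[of i] by auto
  qed
  ultimately show ?thesis by simp
qed

lemma nilpotent_negating_involution:
  fixes R (structure) and n :: nat
  defines "R \<equiv> mat_ring_H n"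
  assumes X: "X \<in> carrier_mat n n" "nilpotent_mat X"
  obtains \<tau> where "\<tau> \<in> carrier R" "\<tau> \<otimes> \<tau> = \<one>" "\<tau> \<otimes> X \<otimes> \<tau> = \<ominus> X" "Nrd \<tau> = 1"
proof -
  interpret ring R unfolding R_def by (rule ring_mat_ring_1)
  note simps = ring_mat_simps[where ty = "TYPE(quat)" and n = n and b = "()", folded R_def]
  obtain k where "X ^\<^sub>m k = 0\<^sub>m n n" using X by (auto simp: nilpotent_mat_def)
  then have "X [^] k \<otimes> \<one> = \<zero>"
    using pow_mat_ring_pow[OF X(1), of k "()"] X(1) by (simp add: R_def[symmetric] simps)
  moreover have "\<exists>b\<in>carrier R. a \<otimes> b \<otimes> a = a" if "a \<in> carrier R" for a
    using mat_von_Neumann_regular[of a n] that by (simp add: simps del: assoc_mult_mat)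
  \<comment> \<open>The corner is now the whole matrix ring, with \<open>\<one>\<close> in the role
    of \<open>f\<close>.\<close>
  ultimately obtain e where e: "e \<in> carrier R" "e \<otimes> e = e" "e \<otimes> X \<oplus> X \<otimes> e = X"
    using nilpotent_odd_idempotent[of X \<one> k] X by (auto simp: simps)
  have Xc: "X \<in> carrier R" using X(1) by (simp add: simps)
  show ?thesis
  proof
    show "\<one> \<ominus> (e \<oplus> e) \<in> carrier R" using e(1) by simp
    show "(\<one> \<ominus> (e \<oplus> e)) \<otimes> (\<one> \<ominus> (e \<oplus> e)) = \<one>"
      using e(1,2) by (rule reflection_of_idempotent)
    show "(\<one> \<ominus> (e \<oplus> e)) \<otimes> X \<otimes> (\<one> \<ominus> (e \<oplus> e)) = \<ominus> X"
      using e(1) Xc e(2,3) by (rule reflection_negates_odd)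
    show "Nrd (\<one> \<ominus> (e \<oplus> e)) = 1"
      using Nrd_reflection_of_idempotent[of e n] e(1,2) by (simp add: simps flip: R_def)
  qed
qed

theorem theorem5p3:
  fixes n :: nat and X :: "quat mat"
  assumes "n > 2" and "X \<in> sl_H n" and "nilpotent_mat X"
  shows "strongly_Ad_real n (SL_H n) X"
proof -
  interpret ring "mat_ring_H n" by (rule ring_mat_ring_1)
  have X: "X \<in> carrier_mat n n" using assms(2) by (simp add: sl_H_def)
  obtain \<tau> where \<tau>: "\<tau> \<in> carrier_mat n n" "\<tau> * \<tau> = 1\<^sub>m n" "\<tau> * X * \<tau> = - X" "Nrd \<tau> = 1"
    using nilpotent_negating_involution[OF X assms(3)] a_inv_ring_mat[OF X]
    by (metis ring_mat_simps(1,3,5))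
  have "\<tau> \<in> GL_H n"
    using \<tau>(1,2) by (auto simp: GL_H_def Units_def ring_mat_simps)
  \<comment> \<open>An involution is its own inverse, so the adjoint action of \<open>\<tau>\<close>
    on \<open>X\<close> is \<open>\<tau> * X * \<tau>\<close>.\<close>
  moreover have "inv\<^bsub>mat_ring_H n\<^esub> \<tau> = \<tau>"
    using \<tau>(1,2) by (intro inv_char) (simp_all add: ring_mat_simps)
  ultimately show ?thesis
    using \<tau> by (auto simp: strongly_Ad_real_def SL_H_def Ad_H_def)
qed

end
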